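(* Let $r\ge 1$ and $\lambda>0$. Given two finite scenario trees of height $T$, the transport plan on pairs of leaves obtained from the recursive (nested) Sinkhorn procedure, $$\pi_{ij}=\prod_{t=0}^{T-1}\pi(i_{t+1},j_{t+1}\mid i_t,j_t)\qquad (i_T=i,\ j_T=j),$$ where $(i_0,\dots,i_{T-1},i)$ and $(j_0,\dots,j_{T-1},j)$ are the paths from the roots to the leaves $i$ and $j$ and the factors are the optimal solutions of the stagewise problems, coincides with the optimal transport plan of the problem $$\begin{aligned} \text{minimize in }\pi\quad & \sum_{i,j}\Bigl(\pi_{ij}\, d_{ij}^r+\frac1\lambda\pi_{ij}\log\pi_{ij}\Bigr)\\ \text{subject to}\quad & \sum_{j\succ j_t}\pi(i,j\mid i_t,j_t)=P(i\mid i_t)\quad\text{for all } i_t\prec i \text{ and all } j_t,\\ & \sum_{i\succ i_t}\pi(i,j\mid i_t,j_t)=\tilde P(j\mid j_t)\quad\text{for all } j_t\prec j\text{ and all } i_t,\\ & \pi_{ij}>0\ \text{ and }\ \sum_{i,j}\pi_{ij}=1, \end{aligned}$$ where $i,j$ range over the leaves of the two trees and $i_t,j_t$ range over nodes of the same stage $t\in\{0,\dots,T-1\}$.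
   Context: Trees: A finite-valued process with its filtration is modelled by a finite rooted tree of height $T$. $\mathcal N_t$ (resp. $\tilde{\mathcal N}_t$) denotes the set of nodes at stage $t=0,\dots,T$ of the first (resp. second) tree; stage $0$ consists of the root only ($i_0$, resp. $j_0$), and all leaves are at stage $T$. We write $m\prec i$ (equivalently $i\succ m$) if $m$ is a (not necessarily immediate) predecessor of $i$, and $i_t+$ (resp. $j_t+$) for the set of immediate successors of node $i_t$ (resp. $j_t$). The first tree carries a probability measure $P$ on its leaves and the second a probability measure $\tilde P$ on its leaves, all leaves having positive probability; the probability of an inner node is the total probability of the leaves succeeding it, and $P(i\mid i_t)$ (resp. $\tilde P(j\mid j_t)$) denotes the conditional probability of a successor $i$ of $i_t$ (resp. $j$ of $j_t$). For leaves $i\in\mathcal N_T$, $j\in\tilde{\mathcal N}_T$, $d_{ij}\ge 0$ is the distance between the trajectories ending in $i$ and $j$. For a positive measure $\pi$ on $\mathcal N_T\times\tilde{\mathcal N}_T$, the conditional probabilities are $$\pi(i,j\mid i_t,j_t):=\frac{\pi_{ij}}{\sum_{i'\succ i_t,\,j'\succ j_t}\pi_{i'j'}}\qquad (i\succ i_t,\ j\succ j_t).$$ Recursive (nested) Sinkhorn procedure: set $de^{(T)}(i,j):=d_{ij}^r$ for leaves $i\in\mathcal N_T$, $j\in\tilde{\mathcal N}_T$. For $t=T-1$ down to $0$ and every $i_t\in\mathcal N_t$, $j_t\in\tilde{\mathcal N}_t$, let $de^{(t)}(i_t,j_t)$ be the optimal value, and $\pi(\cdot,\cdot\mid i_t,j_t)$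 the optimal solution, of $$\begin{aligned} \text{minimize}\quad & \sum_{i'\in i_t+,\,j'\in j_t+}\Bigl(\pi(i',j'\mid i_t,j_t)\,de^{(t+1)}(i',j')+\frac1\lambda\,\pi(i',j'\mid i_t,j_t)\log\pi(i',j'\mid i_t,j_t)\Bigr)\\ \text{subject to}\quad & \sum_{j'\in j_t+}\pi(i',j'\mid i_t,j_t)=P(i'\mid i_t),\quad i'\in i_t+,\\ & \sum_{i'\in i_t+}\pi(i',j'\mid i_t,j_t)=\tilde P(j'\mid j_t),\quad j'\in j_t+,\\ & \pi(i',j'\mid i_t,j_t)>0 . \end{aligned}$$ *)

theory Defs
  imports "HOL-Probability.Probability"
begin

text \<open>
  An arc \<open>(m, i)\<close> says that \<open>i\<close> is an immediate successor of \<open>m\<close>; the probability measure of the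
  tree lives on its leaves.
\<close>

record 'a stree =
  tnodes :: "'a set"
  troot :: "'a"
  tarcs :: "('a \<times> 'a) set"
  tprob :: "'a pmf"

definition succs :: "'a stree \<Rightarrow> 'a \<Rightarrow> 'a set" where
  "succs A m = tarcs A `` {m}"

definition stage :: "'a stree \<Rightarrow> nat \<Rightarrow> 'a set" where
  "stage A t = (tarcs A ^^ t) `` {troot A}"

definition leaves :: "'a stree \<Rightarrow> 'a set" where
  "leaves A = {i \<in> tnodes A. succs A i = {}}"

text \<open>
  Every node other than the root has exactly one immediate predecessor and is reachable from the
  root. As every leaf is at stage \<open>T\<close>, the stages partition the node set, \<open>stage A T\<close> is
  exactly the set of leaves, and \<open>T\<close> is the height.
\<close>

definition scenario_tree :: "nat \<Rightarrow> 'a stree \<Rightarrow> bool" where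
  "scenario_tree T A \<longleftrightarrow>
     finite (tnodes A) \<and> troot A \<in> tnodes A \<and> tarcs A \<subseteq> tnodes A \<times> tnodes A \<and>
     (\<forall>m. (m, troot A) \<notin> tarcs A) \<and>
     (\<forall>i \<in> tnodes A - {troot A}. \<exists>!m. (m, i) \<in> tarcs A) \<and>
     (\<forall>i \<in> tnodes A. (troot A, i) \<in> (tarcs A)\<^sup>*) \<and>
     leaves A \<subseteq> stage A T \<and>
     set_pmf (tprob A) = leaves A"

definition prec :: "'a stree \<Rightarrow> 'a \<Rightarrow> 'a \<Rightarrow> bool" where
  "prec A m i \<longleftrightarrow> (m, i) \<in> (tarcs A)\<^sup>+"

definition leaves_below :: "'a stree \<Rightarrow> 'a \<Rightarrow> 'a set" where
  "leaves_below A m = {i \<in> leaves A. prec A m i}"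

text \<open>The probability of a leaf itself is covered by the alternative \<open>l = i\<close>.\<close>

definition node_prob :: "'a stree \<Rightarrow> 'a \<Rightarrow> real" where
  "node_prob A i = measure_pmf.prob (tprob A) {l \<in> leaves A. l = i \<or> prec A i l}"

text \<open>\<open>cprob A i m\<close> is $P(i \mid m)$, meant for a (not necessarily immediate) successor \<open>i\<close> of \<open>m\<close>.\<close>

definition cprob :: "'a stree \<Rightarrow> 'a \<Rightarrow> 'a \<Rightarrow> real" where
  "cprob A i m = node_prob A i / node_prob A m"

text \<open>
  The unique node at stage \<open>t\<close> on the path from the root to the leaf \<open>i\<close>
  (\<open>t \<le> T\<close>; for \<open>t = T\<close> it is \<open>i\<close> itself).
\<close>

definition path_node :: "'a stree \<Rightarrow> 'a \<Rightarrow> nat \<Rightarrow> 'a" where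
  "path_node A i t = (THE m. m \<in> stage A t \<and> (m = i \<or> prec A m i))"

text \<open>\<open>plan_cond A B p i j m n\<close> is $\pi(i,j \mid m,n)$ for a measure $\pi$ on pairs of leaves.\<close>

definition plan_cond ::
    "'a stree \<Rightarrow> 'b stree \<Rightarrow> ('a \<Rightarrow> 'b \<Rightarrow> real) \<Rightarrow> 'a \<Rightarrow> 'b \<Rightarrow> 'a \<Rightarrow> 'b \<Rightarrow> real" where
  "plan_cond A B p i j m n =
     p i j / (\<Sum>i' \<in> leaves_below A m. \<Sum>j' \<in> leaves_below B n. p i' j')"

definition entropic_cost ::
    "real \<Rightarrow> ('a \<Rightarrow> 'b \<Rightarrow> real) \<Rightarrow> 'a set \<Rightarrow> 'b set \<Rightarrow> ('a \<Rightarrow> 'b \<Rightarrow> real) \<Rightarrow> real" where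
  "entropic_cost lam c I J p =
     (\<Sum>i \<in> I. \<Sum>j \<in> J. p i j * c i j + 1 / lam * (p i j * ln (p i j)))"

definition stage_feasible ::
    "'a stree \<Rightarrow> 'b stree \<Rightarrow> 'a \<Rightarrow> 'b \<Rightarrow> ('a \<Rightarrow> 'b \<Rightarrow> real) \<Rightarrow> bool" where
  "stage_feasible A B m n p \<longleftrightarrow>
     (\<forall>i \<in> succs A m. (\<Sum>j \<in> succs B n. p i j) = cprob A i m) \<and>
     (\<forall>j \<in> succs B n. (\<Sum>i \<in> succs A m. p i j) = cprob B j n) \<and>
     (\<forall>i \<in> succs A m. \<forall>j \<in> succs B n. p i j > 0)"

text \<open>
  \<open>(de, q)\<close> is an outcome of the recursive Sinkhorn procedure: \<open>de t m n\<close> is the optimal value and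
  \<open>q m n\<close> an optimal solution of the problem at the pair of nodes \<open>(m, n)\<close> of stage \<open>t\<close>, so
  \<open>q m n i j\<close> is $\pi(i,j \mid m,n)$. Values of \<open>de\<close> and \<open>q\<close> at other arguments are irrelevant.
\<close>

definition nested_sinkhorn ::
    "nat \<Rightarrow> 'a stree \<Rightarrow> 'b stree \<Rightarrow> ('a \<Rightarrow> 'b \<Rightarrow> real) \<Rightarrow> real \<Rightarrow> real \<Rightarrow>
     (nat \<Rightarrow> 'a \<Rightarrow> 'b \<Rightarrow> real) \<Rightarrow> ('a \<Rightarrow> 'b \<Rightarrow> 'a \<Rightarrow> 'b \<Rightarrow> real) \<Rightarrow> bool" where
  "nested_sinkhorn T A B d r lam de q \<longleftrightarrow>
     (\<forall>i \<in> leaves A. \<forall>j \<in> leaves B. de T i j = d i j powr r) \<and>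
     (\<forall>t < T. \<forall>m \<in> stage A t. \<forall>n \<in> stage B t.
        is_arg_min (entropic_cost lam (de (Suc t)) (succs A m) (succs B n))
          (stage_feasible A B m n) (q m n) \<and>
        de t m n = entropic_cost lam (de (Suc t)) (succs A m) (succs B n) (q m n))"

definition sinkhorn_plan ::
    "nat \<Rightarrow> 'a stree \<Rightarrow> 'b stree \<Rightarrow> ('a \<Rightarrow> 'b \<Rightarrow> 'a \<Rightarrow> 'b \<Rightarrow> real) \<Rightarrow> 'a \<Rightarrow> 'b \<Rightarrow> real" where
  "sinkhorn_plan T A B q i j =
     (\<Prod>t<T. q (path_node A i t) (path_node B j t) (path_node A i (Suc t)) (path_node B j (Suc t)))"

definition plan_feasible ::
    "nat \<Rightarrow> 'a stree \<Rightarrow> 'b stree \<Rightarrow> ('a \<Rightarrow> 'b \<Rightarrow> real) \<Rightarrow> bool" where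
  "plan_feasible T A B p \<longleftrightarrow>
     (\<forall>t < T. \<forall>m \<in> stage A t. \<forall>n \<in> stage B t.
        (\<forall>i \<in> leaves_below A m. (\<Sum>j \<in> leaves_below B n. plan_cond A B p i j m n) = cprob A i m) \<and>
        (\<forall>j \<in> leaves_below B n. (\<Sum>i \<in> leaves_below A m. plan_cond A B p i j m n) = cprob B j n)) \<and>
     (\<forall>i \<in> leaves A. \<forall>j \<in> leaves B. p i j > 0) \<and>
     (\<Sum>i \<in> leaves A. \<Sum>j \<in> leaves B. p i j) = 1"

definition optimal_plan ::
    "nat \<Rightarrow> 'a stree \<Rightarrow> 'b stree \<Rightarrow> ('a \<Rightarrow> 'b \<Rightarrow> real) \<Rightarrow> real \<Rightarrow> real \<Rightarrow> ('a \<Rightarrow> 'b \<Rightarrow> real) \<Rightarrow> bool" where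
  "optimal_plan T A B d r lam =
     is_arg_min (entropic_cost lam (\<lambda>i j. d i j powr r) (leaves A) (leaves B)) (plan_feasible T A B)"

end

theory Submission
  imports Defs "HOL-Real_Asymp.Real_Asymp"
begin

text \<open>
  Both problems are linked by the chain rule for the entropy: the cost of a plan, conditioned on a
  pair of nodes, is the stage cost of its one-step conditional probabilities plus their average of
  the conditional costs at the successors. For a feasible plan these one-step conditional
  probabilities are feasible for the stage problems, so by backward induction the conditional cost
  is at least the value of the recursion, with equality for the product of the stage optimisers.
  The constraints are linear in the plan once denominators are cleared, so the feasible set is
  convex, and the strict convexity of \<open>x * ln x\<close> makes the optimal plan unique.
\<close>

subsection \<open>Entropic optimal transport\<close>

lemma xlnx_ge_tangent:
  fixes x m :: real
  assumes "x \<ge> 0" "m > 0"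
  shows "x * ln x \<ge> x * ln m + (x - m)"
proof (cases "x = 0")
  case False
  with assms have x: "x > 0" by simp
  \<comment> \<open>The gap to the tangent at \<open>m\<close> reduces to
    \<open>ln y \<le> y - 1\<close> at \<open>y = m / x\<close>; the case \<open>x = 0\<close> is
    immediate because \<open>0 * ln 0 = 0\<close>.\<close>
  have "x * ln (m / x) \<le> x * (m / x - 1)"
    using x assms by (intro mult_left_mono ln_le_minus_one) auto
  then show ?thesis using x assms by (simp add: ln_div algebra_simps)
qed (use assms in simp)

lemma xlnx_gt_tangent:
  fixes x m :: real
  assumes "x \<ge> 0" "m > 0" "x \<noteq> m"
  shows "x * ln x > x * ln m + (x - m)"
proof (cases "x = 0")
  case False
  with assms have x: "x > 0" by simp
  have "ln (m / x) \<noteq> m / x - 1"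
    using x assms ln_eq_minus_one[of "m / x"] by auto
  then have "ln (m / x) < m / x - 1"
    using x assms ln_le_minus_one[of "m / x"] by force
  then have "x * ln (m / x) < x * (m / x - 1)"
    using x by simp
  then show ?thesis using x assms by (simp add: ln_div algebra_simps)
qed (use assms in simp)

text \<open>The tangent inequalities at the weighted mean \<open>m\<close> are added with weights
  \<open>1 - s\<close> and \<open>s\<close>, and the linear terms cancel. Only \<open>x\<close> may
  vanish; \<open>y > 0\<close> and \<open>s > 0\<close> keep \<open>m\<close> positive.\<close>

lemma xlnx_convex:
  fixes x y s :: real
  assumes "x \<ge> 0" "y > 0" "0 < s" "s \<le> 1"
  defines "m \<equiv> (1 - s) * x + s * y"
  shows "m * ln m \<le> (1 - s) * (x * ln x) + s * (y * ln y)"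
proof -
  have m: "m > 0"
    unfolding m_def using assms by (intro add_nonneg_pos) auto
  have "(1 - s) * (x * ln m + (x - m)) \<le> (1 - s) * (x * ln x)"
    using assms m by (intro mult_left_mono xlnx_ge_tangent) auto
  moreover have "s * (y * ln m + (y - m)) \<le> s * (y * ln y)"
    using assms m by (intro mult_left_mono xlnx_ge_tangent) auto
  moreover have "(1 - s) * (x * ln m + (x - m)) + s * (y * ln m + (y - m)) = m * ln m"
    unfolding m_def by (simp add: algebra_simps)
  ultimately show ?thesis by linarith
qed

lemma xlnx_midpoint:
  fixes x y :: real
  assumes "x > 0" "y > 0"
  defines "m \<equiv> (x + y) / 2"
  shows "2 * (m * ln m) \<le> x * ln x + y * ln y"
    and "x \<noteq> y \<Longrightarrow> 2 * (m * ln m) < x * ln x + y * ln y"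
proof -
  have m: "m > 0" using assms by (simp add: m_def)
  have eq: "(x * ln m + (x - m)) + (y * ln m + (y - m)) = 2 * (m * ln m)"
    by (simp add: m_def field_simps)
  show "2 * (m * ln m) \<le> x * ln x + y * ln y"
    using xlnx_ge_tangent[of x m] xlnx_ge_tangent[of y m] assms(1,2) m eq by linarith
  assume "x \<noteq> y"
  then have "x \<noteq> m" by (simp add: m_def)
  then show "2 * (m * ln m) < x * ln x + y * ln y"
    using xlnx_gt_tangent[of x m] xlnx_ge_tangent[of y m] assms(1,2) m eq by linarith
qed

lemma continuous_on_xlnx: "continuous_on {0..} (\<lambda>x::real. x * ln x)"
  unfolding continuous_on_eq_continuous_within
proof
  fix x :: real
  assume x: "x \<in> {0..}"
  show "continuous (at x within {0..}) (\<lambda>x. x * ln x)"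
  proof (cases "x = 0")
    case True
    \<comment> \<open>The value at 0 is 0, so continuity there is the vanishing limit from the
      right.\<close>
    have "((\<lambda>x::real. x * ln x) \<longlongrightarrow> 0) (at_right 0)" by real_asymp
    with True show ?thesis by (simp add: continuous_within at_within_Ici_at_right)
  qed (use x in \<open>auto intro!: continuous_intros\<close>)
qed

section \<open>Uniqueness and existence of minimisers of the entropic cost\<close>

lemma entropic_cost_minimizer_unique:
  assumes fin: "finite I" "finite J" and lam: "lam > 0"
    and p: "is_arg_min (entropic_cost lam c I J) F p"
    and q: "is_arg_min (entropic_cost lam c I J) F q"
    and mid: "\<And>p q. F p \<Longrightarrow> F q \<Longrightarrow> F (\<lambda>i j. (p i j + q i j) / 2)"
    and pos: "\<And>p i j. F p \<Longrightarrow> i \<in> I \<Longrightarrow> j \<in> J \<Longrightarrow> p i j > 0"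
    and ij: "i \<in> I" "j \<in> J"
  shows "p i j = q i j"
proof (rule ccontr)
  assume ne: "p i j \<noteq> q i j"
  \<comment> \<open>The midpoint of the two minimisers is feasible and, by strict convexity at
    \<open>(i, j)\<close>, would cost less than their average.\<close>
  define s where "s = (\<lambda>i j. (p i j + q i j) / 2)"
  define g where "g = (\<lambda>p i j. p i j * c i j + 1 / lam * (p i j * ln (p i j)))"
  have Fp: "F p" "F q" using p q by (auto simp: is_arg_min_linorder)
  \<comment> \<open>The transport term is linear and cancels, leaving the convexity gap of the
    entropy.\<close>
  have split: "g p i j + g q i j - 2 * g s i j =
      1 / lam * (p i j * ln (p i j) + q i j * ln (q i j) - 2 * (s i j * ln (s i j)))" for i j
  proof -
    have "p i j + q i j = 2 * s i j" by (simp add: s_def)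
    then have "(p i j + q i j) * c i j = 2 * s i j * c i j" by simp
    then show ?thesis by (simp add: g_def algebra_simps add_divide_distrib diff_divide_distrib)
  qed
  have le: "2 * g s i j \<le> g p i j + g q i j" if "i \<in> I" "j \<in> J" for i j
  proof -
    have "0 \<le> g p i j + g q i j - 2 * g s i j"
      unfolding split using xlnx_midpoint(1)[of "p i j" "q i j"] pos[OF Fp(1) that] pos[OF Fp(2) that] lam
      by (simp add: s_def)
    then show ?thesis by simp
  qed
  have "0 < g p i j + g q i j - 2 * g s i j"
    unfolding split using xlnx_midpoint(2)[of "p i j" "q i j"] ne pos[OF Fp(1) ij] pos[OF Fp(2) ij] lam
    by (simp add: s_def)
  then have lt: "2 * g s i j < g p i j + g q i j" by simp
  have "(\<Sum>i\<in>I. \<Sum>j\<in>J. 2 * g s i j) < (\<Sum>i\<in>I. \<Sum>j\<in>J. g p i j + g q i j)"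
    using fin ij le lt by (intro sum_strict_mono_ex1) (auto intro!: sum_mono bexI[of _ i] bexI[of _ j] sum_strict_mono_ex1)
  then have "2 * entropic_cost lam c I J s < entropic_cost lam c I J p + entropic_cost lam c I J q"
    unfolding entropic_cost_def g_def by (simp add: sum.distrib sum_distrib_left)
  moreover have "F s" unfolding s_def using mid Fp by blast
  then have "entropic_cost lam c I J p \<le> entropic_cost lam c I J s"
    "entropic_cost lam c I J q \<le> entropic_cost lam c I J s"
    using p q by (auto simp: is_arg_min_linorder)
  ultimately show False by linarith
qed

definition couplings :: "'a set \<Rightarrow> 'b set \<Rightarrow> ('a \<Rightarrow> real) \<Rightarrow> ('b \<Rightarrow> real) \<Rightarrow> ('a \<Rightarrow> 'b \<Rightarrow> real) set" where
  "couplings I J a b = {p. (\<forall>i\<in>I. (\<Sum>j\<in>J. p i j) = a i) \<and> (\<forall>j\<in>J. (\<Sum>i\<in>I. p i j) = b j) \<and>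
     (\<forall>i\<in>I. \<forall>j\<in>J. p i j \<ge> 0)}"

text \<open>Extended by zero outside \<open>I \<times> J\<close>, the couplings form a compact set
  on which the cost is continuous; the product coupling shows that it is nonempty.\<close>

lemma entropic_cost_minimizer_nonneg:
  assumes fin: "finite I" "finite J"
    and a: "\<And>i. i \<in> I \<Longrightarrow> a i \<ge> 0" and b: "\<And>j. j \<in> J \<Longrightarrow> b j \<ge> 0"
    and sums: "sum a I = 1" "sum b J = 1"
  shows "\<exists>p. is_arg_min (entropic_cost lam c I J) (\<lambda>p. p \<in> couplings I J a b) p"
proof -
  \<comment> \<open>A product of compact intervals and singletons, hence compact by Tychonoff. Plans
    are uncurried so that a single product topology covers all entries.\<close>
  define K where "K = (\<Pi>\<^sub>E z\<in>(UNIV::('a \<times> 'b) set). if z \<in> I \<times> J then {0..1::real} else {0})"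
  define C where "C = {x::'a \<times> 'b \<Rightarrow> real. (\<forall>i\<in>I. (\<Sum>j\<in>J. x (i, j)) = a i) \<and> (\<forall>j\<in>J. (\<Sum>i\<in>I. x (i, j)) = b j)}"
  define F where "F = (\<lambda>x::'a \<times> 'b \<Rightarrow> real. entropic_cost lam c I J (curry x))"
  have "compactin (product_topology (\<lambda>_. euclidean) UNIV) K"
    unfolding K_def compactin_PiE by auto
  then have compact: "compact K" by (simp add: euclidean_product_topology)
  have "C = (\<Inter>i\<in>I. {x. (\<Sum>j\<in>J. x (i, j)) = a i}) \<inter> (\<Inter>j\<in>J. {x. (\<Sum>i\<in>I. x (i, j)) = b j})"
    by (auto simp: C_def)
  also have "closed \<dots>"
    by (intro closed_Int closed_INT ballI closed_Collect_eq continuous_intros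
        continuous_on_product_coordinates)
  finally have compactKC: "compact (K \<inter> C)" by (rule compact_Int_closed[OF compact])
  have restr: "(\<lambda>(i, j). if i \<in> I \<and> j \<in> J then p i j else 0) \<in> K \<inter> C"
    if p: "p \<in> couplings I J a b" for p
  proof -
    \<comment> \<open>An entry is at most its row sum, which is at most the total 1, so the box
      \<open>K\<close> loses no coupling.\<close>
    have "p i j \<le> 1" if "i \<in> I" "j \<in> J" for i j
    proof -
      have "p i j \<le> (\<Sum>j\<in>J. p i j)"
        using p that fin by (intro member_le_sum) (auto simp: couplings_def)
      also have "\<dots> = a i" using p that by (auto simp: couplings_def)
      also have "\<dots> \<le> sum a I" using that a fin by (intro member_le_sum) auto
      finally show ?thesis using sums by simp
    qed
    then show ?thesis
      using p by (auto simp: K_def C_def couplings_def PiE_iff)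
  qed
  have "(\<lambda>i j. a i * b j) \<in> couplings I J a b"
    using a b sums by (auto simp: couplings_def sum_distrib_left[symmetric] sum_distrib_right[symmetric])
  from restr[OF this] have ne: "K \<inter> C \<noteq> {}" by blast
  have coord: "continuous_on (K \<inter> C) (\<lambda>x. x z)" for z
    by (rule continuous_on_subset[OF continuous_on_product_coordinates]) auto
  have nonneg: "x z \<ge> 0" if "x \<in> K \<inter> C" for x z
  proof -
    have "x z \<in> (if z \<in> I \<times> J then {0..1} else {0})" using that PiE_mem[of x UNIV _ z] unfolding K_def by blast
    then show ?thesis by (auto split: if_splits)
  qed
  have xlnx: "continuous_on (K \<inter> C) (\<lambda>x. x z * ln (x z))" for z
    by (rule continuous_on_compose2[OF continuous_on_xlnx coord]) (use nonneg in blast)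
  have "continuous_on (K \<inter> C) F"
    unfolding F_def entropic_cost_def curry_def
    by (intro continuous_on_sum continuous_on_add continuous_on_mult_left continuous_on_mult_right
        xlnx coord)
  from continuous_attains_inf[OF compactKC ne this]
  obtain x where x: "x \<in> K \<inter> C" and min: "\<And>y. y \<in> K \<inter> C \<Longrightarrow> F x \<le> F y" by blast
  have "curry x \<in> couplings I J a b"
    using x nonneg[OF x] by (auto simp: C_def couplings_def)
  moreover have "entropic_cost lam c I J (curry x) \<le> entropic_cost lam c I J p"
    if "p \<in> couplings I J a b" for p
  proof -
    have "F x \<le> F (\<lambda>(i, j). if i \<in> I \<and> j \<in> J then p i j else 0)"
      by (intro min restr that)
    also have "\<dots> = entropic_cost lam c I J p"
      unfolding F_def entropic_cost_def by (intro sum.cong) auto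
    finally show ?thesis by (simp add: F_def)
  qed
  ultimately show ?thesis by (auto simp: is_arg_min_linorder)
qed

text \<open>
  Moving a coupling with a zero entry towards the product coupling by \<open>s\<close> changes the cost by
  \<open>O(s)\<close> plus a positive multiple of \<open>s * ln s\<close>, hence lowers it for small \<open>s\<close>.
\<close>

lemma entropic_cost_minimizer_pos:
  assumes fin: "finite I" "finite J"
    and a: "\<And>i. i \<in> I \<Longrightarrow> a i > 0" and b: "\<And>j. j \<in> J \<Longrightarrow> b j > 0"
    and sums: "sum a I = 1" "sum b J = 1" and lam: "lam > 0"
    and p: "is_arg_min (entropic_cost lam c I J) (\<lambda>p. p \<in> couplings I J a b) p"
    and ij: "i \<in> I" "j \<in> J"
  shows "p i j > 0"
proof (rule ccontr)
  assume "\<not> p i j > 0"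
  have pc: "p \<in> couplings I J a b" using p by (simp add: is_arg_min_linorder)
  then have p0: "\<And>i j. i \<in> I \<Longrightarrow> j \<in> J \<Longrightarrow> p i j \<ge> 0" by (auto simp: couplings_def)
  with \<open>\<not> p i j > 0\<close> ij have zero: "p i j = 0" by force
  define u where "u = (\<lambda>i j. a i * b j)"
  have u: "\<And>i j. i \<in> I \<Longrightarrow> j \<in> J \<Longrightarrow> u i j > 0" using a b by (auto simp: u_def)
  have uc: "u \<in> couplings I J a b"
    using a b sums by (auto simp: u_def couplings_def less_imp_le sum_distrib_left[symmetric] sum_distrib_right[symmetric])
  define g where "g = (\<lambda>p i j. p i j * c i j + 1 / lam * (p i j * ln (p i j)))"
  define w where "w = (\<lambda>s i j. (1 - s) * p i j + s * u i j)"
  have cost: "entropic_cost lam c I J p = (\<Sum>i\<in>I. \<Sum>j\<in>J. g p i j)" for p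
    by (simp add: entropic_cost_def g_def)
  \<comment> \<open>The mass that the product coupling \<open>u\<close> puts on the zero entries of
    \<open>p\<close>; it is positive since \<open>(i, j)\<close> is one of them.\<close>
  define Y where "Y = (\<Sum>i\<in>I. \<Sum>j\<in>J. if p i j = 0 then u i j else 0)"
  have "(if p i j = 0 then u i j else 0) \<le> (\<Sum>j\<in>J. if p i j = 0 then u i j else 0)"
    using fin ij u by (intro member_le_sum) (auto simp: less_imp_le)
  also have "\<dots> \<le> Y"
    unfolding Y_def using fin ij u by (intro member_le_sum) (auto intro!: sum_nonneg simp: less_imp_le)
  finally have Y: "Y > 0" using zero u[OF ij] by simp
  \<comment> \<open>Minimality of \<open>p\<close> against \<open>w s\<close>, divided by
    \<open>s\<close>: the right side is fixed, while the left side is unbounded as \<open>s\<close>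
    tends to 0.\<close>
  have bound: "- ln s * (Y / lam) \<le> entropic_cost lam c I J u - entropic_cost lam c I J p"
    if s: "0 < s" "s < 1" for s
  proof -
    \<comment> \<open>At a zero entry \<open>w s i j = s * u i j\<close>, whose logarithm splits off
      the term with \<open>ln s\<close>; elsewhere convexity suffices.\<close>
    have le: "g (w s) i j \<le> (1 - s) * g p i j + s * g u i j + s * ln s / lam * (if p i j = 0 then u i j else 0)"
      if ij: "i \<in> I" "j \<in> J" for i j
    proof (cases "p i j = 0")
      case True
      then show ?thesis
        using s u[OF ij] lam by (simp add: g_def w_def ln_mult field_simps)
    next
      case False
      have "w s i j * ln (w s i j) \<le> (1 - s) * (p i j * ln (p i j)) + s * (u i j * ln (u i j))"
        unfolding w_def using s p0[OF ij] u[OF ij] by (intro xlnx_convex) auto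
      then have "w s i j * ln (w s i j) / lam \<le> ((1 - s) * (p i j * ln (p i j)) + s * (u i j * ln (u i j))) / lam"
        using lam by (intro divide_right_mono) auto
      then show ?thesis using False by (simp add: g_def w_def algebra_simps add_divide_distrib diff_divide_distrib)
    qed
    have "w s \<in> couplings I J a b"
      unfolding couplings_def mem_Collect_eq
    proof (intro conjI ballI)
      fix i assume "i \<in> I"
      then have "(\<Sum>j\<in>J. w s i j) = (1 - s) * a i + s * a i"
        using pc uc by (simp add: couplings_def w_def sum.distrib flip: sum_distrib_left)
      then show "(\<Sum>j\<in>J. w s i j) = a i" by (simp add: algebra_simps)
    next
      fix j assume "j \<in> J"
      then have "(\<Sum>i\<in>I. w s i j) = (1 - s) * b j + s * b j"
        using pc uc by (simp add: couplings_def w_def sum.distrib flip: sum_distrib_left)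
      then show "(\<Sum>i\<in>I. w s i j) = b j" by (simp add: algebra_simps)
    next
      fix i j assume "i \<in> I" "j \<in> J"
      then show "w s i j \<ge> 0"
        using s p0[of i j] u[of i j] by (simp add: w_def)
    qed
    then have "entropic_cost lam c I J p \<le> entropic_cost lam c I J (w s)"
      using p by (auto simp: is_arg_min_linorder)
    also have "\<dots> \<le> (\<Sum>i\<in>I. \<Sum>j\<in>J. (1 - s) * g p i j + s * g u i j + s * ln s / lam * (if p i j = 0 then u i j else 0))"
      unfolding cost by (intro sum_mono le)
    also have "\<dots> = (1 - s) * entropic_cost lam c I J p + s * entropic_cost lam c I J u + s * ln s / lam * Y"
      unfolding cost Y_def by (simp add: sum.distrib sum_distrib_left)
    finally have "s * (- ln s * (Y / lam)) \<le> s * (entropic_cost lam c I J u - entropic_cost lam c I J p)"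
      by (simp add: algebra_simps)
    then show ?thesis using s by (simp only: mult_le_cancel_left_pos)
  qed
  \<comment> \<open>Chosen so that \<open>s = exp (- M)\<close> makes the left side of
    \<open>bound\<close> exceed the absolute value of the right side by
    \<open>Y / lam\<close>.\<close>
  define M where "M = \<bar>entropic_cost lam c I J u - entropic_cost lam c I J p\<bar> / (Y / lam) + 1"
  have Ylam: "Y / lam > 0" using Y lam by simp
  have "M > 0" unfolding M_def using Ylam by (intro add_nonneg_pos divide_nonneg_pos) auto
  then have "M * (Y / lam) \<le> entropic_cost lam c I J u - entropic_cost lam c I J p"
    using bound[of "exp (- M)"] by simp
  moreover have "M * (Y / lam) = \<bar>entropic_cost lam c I J u - entropic_cost lam c I J p\<bar> + Y / lam"
    unfolding M_def using Y lam by (simp add: field_simps)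
  ultimately show False using Ylam by linarith
qed

text \<open>A minimiser over the nonnegative couplings that is itself positive also minimises over
  the smaller set of positive ones.\<close>

lemma entropic_cost_minimizer_exists:
  assumes fin: "finite I" "finite J"
    and a: "\<And>i. i \<in> I \<Longrightarrow> a i > 0" and b: "\<And>j. j \<in> J \<Longrightarrow> b j > 0"
    and sums: "sum a I = 1" "sum b J = 1" and lam: "lam > 0"
  shows "\<exists>p. is_arg_min (entropic_cost lam c I J)
    (\<lambda>p. (\<forall>i\<in>I. (\<Sum>j\<in>J. p i j) = a i) \<and> (\<forall>j\<in>J. (\<Sum>i\<in>I. p i j) = b j) \<and>
      (\<forall>i\<in>I. \<forall>j\<in>J. p i j > 0)) p"
proof -
  obtain p where p: "is_arg_min (entropic_cost lam c I J) (\<lambda>p. p \<in> couplings I J a b) p"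
    using entropic_cost_minimizer_nonneg[OF fin _ _ sums] a b by (metis less_imp_le)
  have "p i j > 0" if "i \<in> I" "j \<in> J" for i j
    using entropic_cost_minimizer_pos[OF fin a b sums lam p that] .
  with p show ?thesis
    by (intro exI[of _ p]) (auto simp: is_arg_min_linorder couplings_def less_imp_le)
qed

subsection \<open>Scenario trees\<close>

locale tree =
  fixes T :: nat and A :: "'a stree"
  assumes tree: "scenario_tree T A"
begin

text \<open>Reflexive, so that a leaf lies below itself and inductions over stages can start at the
  leaves; before stage \<open>T\<close> it agrees with \<open>leaves_below\<close>.\<close>

definition below :: "'a \<Rightarrow> 'a set" where
  "below m = {l \<in> leaves A. (m, l) \<in> (tarcs A)\<^sup>*}"

lemma finite_nodes: "finite (tnodes A)"
  using tree by (simp add: scenario_tree_def)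

lemma parent_unique: "(m, i) \<in> tarcs A \<Longrightarrow> (m', i) \<in> tarcs A \<Longrightarrow> m = m'"
  using tree unfolding scenario_tree_def by blast

lemma root_no_parent: "(m, troot A) \<notin> tarcs A"
  using tree unfolding scenario_tree_def by blast

lemma ancestor_unique:
  "(m, i) \<in> tarcs A ^^ k \<Longrightarrow> (m', i) \<in> tarcs A ^^ k \<Longrightarrow> m = m'"
proof (induction k arbitrary: i)
  case (Suc k)
  then show ?case by (auto dest: parent_unique)
qed simp

lemma stage_Suc_iff: "i \<in> stage A (Suc t) \<longleftrightarrow> (\<exists>m \<in> stage A t. (m, i) \<in> tarcs A)"
  by (auto simp: stage_def)

lemma stage_0: "stage A 0 = {troot A}"
  by (auto simp: stage_def)

text \<open>Parents are unique and the root has none, so tracing a node back can reach the root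
  after only one number of steps.\<close>

lemma stage_unique: "i \<in> stage A t \<Longrightarrow> i \<in> stage A t' \<Longrightarrow> t = t'"
proof (induction t arbitrary: t' i)
  case 0
  then show ?case by (cases t') (auto simp: stage_0 stage_Suc_iff root_no_parent)
next
  case (Suc t)
  then show ?case
    by (cases t') (auto simp: stage_0 stage_Suc_iff root_no_parent dest: parent_unique)
qed

lemma stage_relpow: "m \<in> stage A t \<Longrightarrow> (m, i) \<in> tarcs A ^^ k \<Longrightarrow> i \<in> stage A (t + k)"
  unfolding stage_def by (auto simp: relpow_add)

lemma stage_ancestor:
  assumes "i \<in> stage A t" "s \<le> t"
  obtains m where "m \<in> stage A s" "(m, i) \<in> (tarcs A)\<^sup>*"
proof -
  have "(troot A, i) \<in> tarcs A ^^ s O tarcs A ^^ (t - s)"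
    using assms by (simp add: stage_def flip: relpow_add)
  then show ?thesis using that by (auto simp: stage_def relpow_imp_rtrancl)
qed

lemma stage_succs: "m \<in> stage A t \<Longrightarrow> i \<in> succs A m \<Longrightarrow> i \<in> stage A (Suc t)"
  by (auto simp: stage_Suc_iff succs_def)

lemma stage_ancestor_unique:
  assumes "m \<in> stage A t" "m' \<in> stage A t" "(m, i) \<in> (tarcs A)\<^sup>*" "(m', i) \<in> (tarcs A)\<^sup>*"
  shows "m = m'"
proof -
  obtain k k' where k: "(m, i) \<in> tarcs A ^^ k" "(m', i) \<in> tarcs A ^^ k'"
    using assms(3,4) by (meson rtrancl_imp_relpow)
  \<comment> \<open>The node \<open>i\<close> has a single stage, which forces the two paths to have
    equal length.\<close>
  then have "t + k = t + k'" using assms(1,2) stage_relpow stage_unique by meson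
  with k show ?thesis using ancestor_unique by auto
qed

lemma node_stage: "i \<in> tnodes A \<Longrightarrow> \<exists>t. i \<in> stage A t"
  using tree unfolding scenario_tree_def stage_def by (meson Image_singleton_iff rtrancl_imp_relpow)

lemma arc_nodes: "(m, i) \<in> tarcs A \<Longrightarrow> m \<in> tnodes A \<and> i \<in> tnodes A"
  using tree unfolding scenario_tree_def by blast

lemma stage_nodes: "i \<in> stage A t \<Longrightarrow> i \<in> tnodes A"
  using tree by (cases t) (auto simp: stage_0 stage_Suc_iff scenario_tree_def)

lemma leaf_stage: "l \<in> leaves A \<Longrightarrow> l \<in> stage A T"
  using tree unfolding scenario_tree_def by blast

text \<open>A cycle would place a node at two stages, and a finite acyclic relation has a
  well-founded converse. This allows induction from the leaves towards the root.\<close>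

lemma wf_arcs: "wf ((tarcs A)\<inverse>)"
proof (rule finite_acyclic_wf_converse)
  show "finite (tarcs A)"
    using tree finite_subset[of "tarcs A" "tnodes A \<times> tnodes A"] by (auto simp: scenario_tree_def)
  show "acyclic (tarcs A)"
  proof (rule acyclicI, intro allI notI)
    fix x assume "(x, x) \<in> (tarcs A)\<^sup>+"
    then obtain k where k: "k > 0" "(x, x) \<in> tarcs A ^^ k" by (auto simp: trancl_power)
    moreover have "x \<in> tnodes A"
      using \<open>(x, x) \<in> (tarcs A)\<^sup>+\<close> by (auto dest: tranclD arc_nodes)
    then obtain t where "x \<in> stage A t" using node_stage by blast
    ultimately show False using stage_relpow[of x t x k] stage_unique[of x t "t + k"] by simp
  qed
qed

lemma below_nonempty: "m \<in> tnodes A \<Longrightarrow> below m \<noteq> {}"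
proof (induction m rule: wf_induct_rule[OF wf_arcs])
  case (1 m)
  show ?case
  proof (cases "succs A m = {}")
    case True
    with 1 show ?thesis by (auto simp: below_def leaves_def)
  next
    case False
    then obtain i where i: "(m, i) \<in> tarcs A" by (auto simp: succs_def)
    with 1 arc_nodes have "below i \<noteq> {}" by blast
    with i show ?thesis by (auto simp: below_def intro: converse_rtrancl_into_rtrancl)
  qed
qed

lemma stage_le:
  assumes "m \<in> stage A t" shows "t \<le> T"
proof -
  obtain l where l: "l \<in> leaves A" "(m, l) \<in> (tarcs A)\<^sup>*"
    using below_nonempty stage_nodes[OF assms] by (auto simp: below_def)
  then obtain k where "(m, l) \<in> tarcs A ^^ k" by (meson rtrancl_imp_relpow)
  then have "T = t + k" using stage_relpow[OF assms] leaf_stage[OF l(1)] stage_unique by blast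
  then show ?thesis by simp
qed

lemma stage_T: "stage A T = leaves A"
proof
  show "stage A T \<subseteq> leaves A"
  proof
    fix m assume m: "m \<in> stage A T"
    have "succs A m = {}" using stage_succs[OF m] stage_le by fastforce
    with m show "m \<in> leaves A" by (simp add: leaves_def stage_nodes)
  qed
qed (use leaf_stage in blast)

lemma below_leaf:
  assumes "m \<in> leaves A" shows "below m = {m}"
proof -
  have "l = m" if "(m, l) \<in> (tarcs A)\<^sup>*" for l
    using that assms by (auto simp: leaves_def succs_def elim: converse_rtranclE)
  with assms show ?thesis by (auto simp: below_def)
qed

lemma finite_leaves: "finite (leaves A)"
  using finite_nodes by (simp add: leaves_def)

lemma finite_below: "finite (below m)"
  using finite_leaves by (simp add: below_def)

lemma below_subset: "below m \<subseteq> leaves A"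
  by (auto simp: below_def)

lemma finite_succs: "finite (succs A m)"
  by (rule finite_subset[OF _ finite_nodes]) (auto simp: succs_def dest: arc_nodes)

lemma stage_leaf_iff: "m \<in> stage A t \<Longrightarrow> m \<in> leaves A \<longleftrightarrow> t = T"
  using stage_T stage_unique by blast

lemma leaves_below_eq:
  assumes "m \<in> stage A t" "t < T" shows "leaves_below A m = below m"
  using assms stage_leaf_iff[OF assms(1)]
  by (auto simp: leaves_below_def below_def prec_def rtrancl_eq_or_trancl)

lemma below_root: "below (troot A) = leaves A"
  using tree by (auto simp: below_def leaves_def scenario_tree_def)

text \<open>Distinct successors of \<open>m\<close> share a stage and hence no descendants, so the
  leaves below them partition those below \<open>m\<close>; \<open>t < T\<close> ensures that
  \<open>m\<close> is not itself a leaf.\<close>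

lemma sum_below:
  assumes "m \<in> stage A t" "t < T"
  shows "(\<Sum>l\<in>below m. f l) = (\<Sum>i\<in>succs A m. \<Sum>l\<in>below i. f l)"
proof -
  have "below m = (\<Union>i\<in>succs A m. below i)"
    using assms stage_leaf_iff[OF assms(1)]
    by (auto simp: below_def succs_def elim: converse_rtranclE intro: converse_rtrancl_into_rtrancl)
  moreover have "below i \<inter> below i' = {}" if "i \<in> succs A m" "i' \<in> succs A m" "i \<noteq> i'" for i i'
    using stage_ancestor_unique[of i "Suc t" i'] stage_succs[OF assms(1)] that by (auto simp: below_def)
  ultimately show ?thesis
    by (simp add: sum.UNION_disjoint finite_succs finite_below)
qed

section \<open>Node probabilities and conditional probabilities\<close>

lemma node_prob_below: "node_prob A m = measure_pmf.prob (tprob A) (below m)"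
proof -
  have "{l \<in> leaves A. l = m \<or> prec A m l} = below m"
    by (auto simp: below_def prec_def rtrancl_eq_or_trancl)
  then show ?thesis by (simp add: node_prob_def)
qed

lemma node_prob_eq: "node_prob A m = (\<Sum>l\<in>below m. pmf (tprob A) l)"
  by (simp add: node_prob_below measure_measure_pmf_finite finite_below)

lemma node_prob_pos:
  assumes "m \<in> tnodes A" shows "node_prob A m > 0"
  unfolding node_prob_eq
proof (rule sum_pos)
  fix l assume "l \<in> below m"
  then have "l \<in> set_pmf (tprob A)" using tree by (auto simp: below_def scenario_tree_def)
  then show "pmf (tprob A) l > 0" by (simp add: pmf_positive)
qed (use below_nonempty[OF assms] finite_below in auto)

lemma cprob_pos: "m \<in> tnodes A \<Longrightarrow> i \<in> tnodes A \<Longrightarrow> cprob A i m > 0"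
  by (simp add: cprob_def node_prob_pos)

lemma cprob_self: "m \<in> tnodes A \<Longrightarrow> cprob A m m = 1"
  using node_prob_pos by (force simp: cprob_def)

lemma cprob_chain: "m' \<in> tnodes A \<Longrightarrow> cprob A i m' * cprob A m' m = cprob A i m"
  using node_prob_pos[of m'] by (simp add: cprob_def)

lemma sum_cprob_succs:
  assumes "m \<in> stage A t" "t < T" shows "(\<Sum>i\<in>succs A m. cprob A i m) = 1"
  using node_prob_pos[OF stage_nodes[OF assms(1)]] sum_below[OF assms, of "pmf (tprob A)"]
  by (simp add: cprob_def node_prob_eq flip: sum_divide_distrib)

text \<open>The node probability of a leaf is its point mass, and conditioning on \<open>i\<close>
  contributes only a common denominator.\<close>

lemma sum_cprob_below:
  assumes "m \<in> tnodes A"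
  shows "(\<Sum>l\<in>below m. cprob A l i) = cprob A m i"
proof -
  have "node_prob A l = pmf (tprob A) l" if "l \<in> below m" for l
    using that below_leaf[of l] by (simp add: node_prob_eq[of l] below_def)
  then show ?thesis
    by (simp add: cprob_def node_prob_eq[of m] flip: sum_divide_distrib)
qed

section \<open>Nodes on the path to a given node\<close>

lemma path_node_eqI:
  assumes "m \<in> stage A t" "(m, i) \<in> (tarcs A)\<^sup>*"
  shows "path_node A i t = m"
  unfolding path_node_def
proof (rule the_equality)
  show "m \<in> stage A t \<and> (m = i \<or> prec A m i)"
    using assms by (auto simp: prec_def rtrancl_eq_or_trancl)
next
  fix k assume "k \<in> stage A t \<and> (k = i \<or> prec A k i)"
  then show "k = m"
    using assms by (auto simp: prec_def intro: stage_ancestor_unique[of _ t])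
qed

lemma path_node_self: "m \<in> stage A t \<Longrightarrow> path_node A m t = m"
  by (simp add: path_node_eqI)

text \<open>The path to \<open>i\<close> runs through \<open>m\<close>, so up to stage
  \<open>t\<close> it is the path to \<open>m\<close>; this lets products along paths be split at a
  stage.\<close>

lemma path_node_ancestor:
  assumes "m \<in> stage A t" "(m, i) \<in> (tarcs A)\<^sup>*" "s \<le> t"
  shows "path_node A i s = path_node A m s"
proof -
  obtain k where "k \<in> stage A s" "(k, m) \<in> (tarcs A)\<^sup>*" using stage_ancestor assms by blast
  then show ?thesis using path_node_eqI rtrancl_trans[OF _ assms(2)] by metis
qed

end

subsection \<open>Plans on pairs of trees\<close>

text \<open>Transposition turns column sums into row sums of the exchanged pair of trees, so only
  rows need a direct argument.\<close>

lemma sinkhorn_plan_swap: "sinkhorn_plan T B A (\<lambda>n m j i. q m n i j) j i = sinkhorn_plan T A B q i j"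
  by (simp add: sinkhorn_plan_def)

section \<open>Masses of node pairs and the chain rule for the cost\<close>

locale tree_pair = A: tree T A + B: tree T B
  for T :: nat and A :: "'a stree" and B :: "'b stree"
begin

text \<open>Extends a plan from pairs of leaves to pairs of inner nodes; ratios of masses at
  successive stages are its one-step conditional probabilities.\<close>

definition mass :: "('a \<Rightarrow> 'b \<Rightarrow> real) \<Rightarrow> 'a \<Rightarrow> 'b \<Rightarrow> real" where
  "mass p m n = (\<Sum>i\<in>A.below m. \<Sum>j\<in>B.below n. p i j)"

definition stagewise_feasible :: "('a \<Rightarrow> 'b \<Rightarrow> 'a \<Rightarrow> 'b \<Rightarrow> real) \<Rightarrow> bool" where
  "stagewise_feasible q \<longleftrightarrow>
     (\<forall>t<T. \<forall>m\<in>stage A t. \<forall>n\<in>stage B t. stage_feasible A B m n (q m n))"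

text \<open>For positive mass this is \<open>mass p m n\<close> times the entropic cost of the plan
  conditioned on \<open>(m, n)\<close>. Keeping that factor avoids weights when summing over
  successor pairs.\<close>

definition cond_cost :: "real \<Rightarrow> ('a \<Rightarrow> 'b \<Rightarrow> real) \<Rightarrow> ('a \<Rightarrow> 'b \<Rightarrow> real) \<Rightarrow> 'a \<Rightarrow> 'b \<Rightarrow> real" where
  "cond_cost lam c p m n =
     (\<Sum>i\<in>A.below m. \<Sum>j\<in>B.below n. p i j * c i j + 1 / lam * (p i j * ln (p i j / mass p m n)))"

lemma sum_below_pair:
  assumes "m \<in> stage A t" "n \<in> stage B t" "t < T"
  shows "(\<Sum>i\<in>A.below m. \<Sum>j\<in>B.below n. f i j) =
    (\<Sum>m'\<in>succs A m. \<Sum>n'\<in>succs B n. \<Sum>i\<in>A.below m'. \<Sum>j\<in>B.below n'. f i j)"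
  unfolding A.sum_below[OF assms(1,3)] B.sum_below[OF assms(2,3)]
  by (intro sum.cong refl sum.swap)

lemma mass_pos:
  assumes "\<forall>i\<in>leaves A. \<forall>j\<in>leaves B. p i j > 0" "m \<in> tnodes A" "n \<in> tnodes B"
  shows "mass p m n > 0"
  unfolding mass_def using assms
  by (intro sum_pos) (auto 0 3 simp: A.finite_below B.finite_below A.below_nonempty B.below_nonempty
      dest: A.below_subset[THEN subsetD] B.below_subset[THEN subsetD])

text \<open>The ratio \<open>p i j / mass p m n\<close> factors through \<open>mass p m' n'\<close>,
  so its logarithm splits. One part gives the conditional cost at the successors; the other is
  constant on each block of leaves and is weighted by the mass of that block.\<close>

lemma cond_cost_step:
  assumes st: "m \<in> stage A t" "n \<in> stage B t" "t < T"
    and pos: "\<forall>i\<in>leaves A. \<forall>j\<in>leaves B. p i j > 0"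
  shows "cond_cost lam c p m n = (\<Sum>m'\<in>succs A m. \<Sum>n'\<in>succs B n.
    cond_cost lam c p m' n' + 1 / lam * (mass p m' n' * ln (mass p m' n' / mass p m n)))"
proof -
  have "(\<Sum>i\<in>A.below m'. \<Sum>j\<in>B.below n'. p i j * c i j + 1 / lam * (p i j * ln (p i j / mass p m n))) =
    cond_cost lam c p m' n' + 1 / lam * (mass p m' n' * ln (mass p m' n' / mass p m n))"
    if s: "m' \<in> succs A m" "n' \<in> succs B n" for m' n'
  proof -
    have pos': "mass p m n > 0" "mass p m' n' > 0"
      using s st A.stage_succs B.stage_succs
      by (auto intro!: mass_pos[OF pos] A.stage_nodes B.stage_nodes)
    have "p i j * c i j + 1 / lam * (p i j * ln (p i j / mass p m n)) =
      (p i j * c i j + 1 / lam * (p i j * ln (p i j / mass p m' n'))) +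
      p i j * (1 / lam * ln (mass p m' n' / mass p m n))"
      if "i \<in> A.below m'" "j \<in> B.below n'" for i j
    proof -
      have "p i j > 0"
        using that pos A.below_subset B.below_subset by blast
      then show ?thesis using pos' by (simp add: ln_div algebra_simps diff_divide_distrib)
    qed
    then have "(\<Sum>i\<in>A.below m'. \<Sum>j\<in>B.below n'. p i j * c i j + 1 / lam * (p i j * ln (p i j / mass p m n))) =
      (\<Sum>i\<in>A.below m'. \<Sum>j\<in>B.below n'. (p i j * c i j + 1 / lam * (p i j * ln (p i j / mass p m' n'))) +
      p i j * (1 / lam * ln (mass p m' n' / mass p m n)))"
      by (intro sum.cong refl)
    also have "\<dots> = cond_cost lam c p m' n' + mass p m' n' * (1 / lam * ln (mass p m' n' / mass p m n))"
      by (simp only: sum.distrib cond_cost_def mass_def sum_distrib_right)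
    finally show ?thesis by simp
  qed
  then show ?thesis
    unfolding cond_cost_def[of lam c p m n] sum_below_pair[OF st] by (intro sum.cong refl) simp
qed

lemma mass_leaf: "i \<in> leaves A \<Longrightarrow> j \<in> leaves B \<Longrightarrow> mass p i j = p i j"
  by (simp add: mass_def A.below_leaf B.below_leaf)

lemma cond_cost_leaf:
  "i \<in> leaves A \<Longrightarrow> j \<in> leaves B \<Longrightarrow> p i j > 0 \<Longrightarrow> cond_cost lam c p i j = mass p i j * c i j"
  by (simp add: cond_cost_def mass_leaf A.below_leaf B.below_leaf)

text \<open>Clears the denominator in the stage cost so that it matches the right side of
  \<open>cond_cost_step\<close>.\<close>

lemma mass_mult_entropic_cost:
  assumes "mass p m n > 0"
  shows "mass p m n * entropic_cost lam e (succs A m) (succs B n) (\<lambda>m' n'. mass p m' n' / mass p m n) =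
    (\<Sum>m'\<in>succs A m. \<Sum>n'\<in>succs B n.
      mass p m' n' * e m' n' + 1 / lam * (mass p m' n' * ln (mass p m' n' / mass p m n)))"
  unfolding entropic_cost_def sum_distrib_left using assms
  by (intro sum.cong refl) (simp add: distrib_left)

text \<open>Backward induction: at the leaves the entropy term vanishes; earlier, the chain rule
  reduces the claim to the successors and to the stage problem.\<close>

lemma cond_cost_ge:
  assumes ns: "nested_sinkhorn T A B d r lam de q"
    and pos: "\<forall>i\<in>leaves A. \<forall>j\<in>leaves B. p i j > 0"
    and feas: "stagewise_feasible (\<lambda>m n m' n'. mass p m' n' / mass p m n)"
    and mn: "m \<in> stage A t" "n \<in> stage B t"
  shows "mass p m n * de t m n \<le> cond_cost lam (\<lambda>i j. d i j powr r) p m n"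
  using A.stage_le[OF mn(1)] mn
proof (induction t arbitrary: m n rule: inc_induct)
  case base
  then show ?case using ns pos by (simp add: A.stage_T B.stage_T cond_cost_leaf nested_sinkhorn_def)
next
  case (step t)
  have "mass p m n > 0"
    using step.prems by (intro mass_pos[OF pos]) (auto intro: A.stage_nodes B.stage_nodes)
  \<comment> \<open>The one-step probabilities compete in the stage problem, whose minimum is
    \<open>de t m n\<close>.\<close>
  moreover have "de t m n \<le> entropic_cost lam (de (Suc t)) (succs A m) (succs B n)
    (\<lambda>m' n'. mass p m' n' / mass p m n)"
    using ns step feas by (auto simp: stagewise_feasible_def nested_sinkhorn_def is_arg_min_linorder)
  ultimately have "mass p m n * de t m n \<le> mass p m n *
      entropic_cost lam (de (Suc t)) (succs A m) (succs B n) (\<lambda>m' n'. mass p m' n' / mass p m n)"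
    by simp
  also have "\<dots> \<le> cond_cost lam (\<lambda>i j. d i j powr r) p m n"
    unfolding mass_mult_entropic_cost[OF \<open>mass p m n > 0\<close>]
      cond_cost_step[OF step.prems \<open>t < T\<close> pos]
    using step A.stage_succs B.stage_succs by (intro sum_mono add_mono) auto
  finally show ?case .
qed

text \<open>The induction of \<open>cond_cost_ge\<close> with equality throughout, because the
  one-step probabilities are now the stage optimisers themselves.\<close>

lemma cond_cost_eq:
  assumes ns: "nested_sinkhorn T A B d r lam de q"
    and pos: "\<forall>i\<in>leaves A. \<forall>j\<in>leaves B. p i j > 0"
    and eq: "\<forall>t<T. \<forall>m\<in>stage A t. \<forall>n\<in>stage B t. \<forall>m'\<in>succs A m. \<forall>n'\<in>succs B n.
      mass p m' n' / mass p m n = q m n m' n'"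
    and mn: "m \<in> stage A t" "n \<in> stage B t"
  shows "cond_cost lam (\<lambda>i j. d i j powr r) p m n = mass p m n * de t m n"
  using A.stage_le[OF mn(1)] mn
proof (induction t arbitrary: m n rule: inc_induct)
  case base
  then show ?case using ns pos by (simp add: A.stage_T B.stage_T cond_cost_leaf nested_sinkhorn_def)
next
  case (step t)
  have "mass p m n > 0"
    using step.prems by (intro mass_pos[OF pos]) (auto intro: A.stage_nodes B.stage_nodes)
  have "de t m n = entropic_cost lam (de (Suc t)) (succs A m) (succs B n) (q m n)"
    using ns step by (auto simp: nested_sinkhorn_def)
  also have "\<dots> = entropic_cost lam (de (Suc t)) (succs A m) (succs B n) (\<lambda>m' n'. mass p m' n' / mass p m n)"
    unfolding entropic_cost_def using eq step by (intro sum.cong refl) simp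
  finally have "mass p m n * de t m n = mass p m n * \<dots>" by simp
  also have "\<dots> = cond_cost lam (\<lambda>i j. d i j powr r) p m n"
    unfolding mass_mult_entropic_cost[OF \<open>mass p m n > 0\<close>]
      cond_cost_step[OF step.prems \<open>t < T\<close> pos]
    using step A.stage_succs B.stage_succs by (intro sum.cong refl) auto
  finally show ?case ..
qed

section \<open>The product plan: partial products, row sums and masses\<close>

lemma sinkhorn_plan_Suc:
  assumes "m \<in> stage A t" "n \<in> stage B t" "i \<in> succs A m" "j \<in> succs B n"
  shows "sinkhorn_plan (Suc t) A B q i j = sinkhorn_plan t A B q m n * q m n i j"
proof -
  have ij: "i \<in> stage A (Suc t)" "j \<in> stage B (Suc t)"
    using assms A.stage_succs B.stage_succs by auto
  have "(m, i) \<in> (tarcs A)\<^sup>*" "(n, j) \<in> (tarcs B)\<^sup>*" using assms by (auto simp: succs_def)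
  \<comment> \<open>With height \<open>t\<close>, \<open>sinkhorn_plan\<close> is the partial
    product up to stage \<open>t\<close>. The paths agree that far, so passing to
    \<open>Suc t\<close> only adds the last factor.\<close>
  then have "path_node A i s = path_node A m s" "path_node B j s = path_node B n s" if "s \<le> t" for s
    using A.path_node_ancestor B.path_node_ancestor assms that by metis+
  then show ?thesis
    unfolding sinkhorn_plan_def
    by (simp add: A.path_node_self[OF ij(1)] B.path_node_self[OF ij(2)] A.path_node_self[OF assms(1)]
        B.path_node_self[OF assms(2)])
qed

text \<open>Backward induction: the stage row constraint sums the last factor over
  \<open>succs B n\<close> to \<open>cprob A m' m\<close>, which the chain rule for conditional
  probabilities absorbs.\<close>

lemma sinkhorn_plan_row:
  assumes feas: "stagewise_feasible q"
    and "m \<in> stage A t" "n \<in> stage B t" "i \<in> A.below m"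
  shows "(\<Sum>j\<in>B.below n. sinkhorn_plan T A B q i j) = cprob A i m * sinkhorn_plan t A B q m n"
  using A.stage_le[OF assms(2)] assms(2-)
proof (induction t arbitrary: m n rule: inc_induct)
  case base
  then have "m \<in> leaves A" "n \<in> leaves B" by (auto simp: A.stage_T B.stage_T)
  with base show ?case
    by (simp add: A.below_leaf B.below_leaf A.cprob_self A.stage_nodes)
next
  case (step t)
  \<comment> \<open>The leaf \<open>i\<close> is at stage \<open>T\<close> and \<open>m\<close> is
    earlier, so the path from \<open>m\<close> to \<open>i\<close> starts with an arc to some
    \<open>m'\<close>.\<close>
  have "m \<noteq> i" using step.prems step.hyps A.stage_leaf_iff[of m t] A.below_subset by blast
  then obtain m' where m': "m' \<in> succs A m" "i \<in> A.below m'"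
    using step.prems by (auto simp: A.below_def succs_def elim: converse_rtranclE)
  have stages: "m' \<in> stage A (Suc t)" "\<And>n'. n' \<in> succs B n \<Longrightarrow> n' \<in> stage B (Suc t)"
    using step.prems m' A.stage_succs B.stage_succs by auto
  have "(\<Sum>j\<in>B.below n. sinkhorn_plan T A B q i j) =
    (\<Sum>n'\<in>succs B n. \<Sum>j\<in>B.below n'. sinkhorn_plan T A B q i j)"
    using step by (intro B.sum_below) auto
  also have "\<dots> = (\<Sum>n'\<in>succs B n. cprob A i m' * sinkhorn_plan t A B q m n * q m n m' n')"
    using step.IH stages m' step.prems by (intro sum.cong refl) (simp add: sinkhorn_plan_Suc)
  also have "\<dots> = cprob A i m' * sinkhorn_plan t A B q m n * cprob A m' m"
    using feas \<open>t < T\<close> step.prems m' by (simp add: stagewise_feasible_def stage_feasible_def flip: sum_distrib_left)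
  also have "\<dots> = (cprob A i m' * cprob A m' m) * sinkhorn_plan t A B q m n" by simp
  also have "cprob A i m' * cprob A m' m = cprob A i m"
    using A.stage_nodes[OF stages(1)] by (rule A.cprob_chain)
  finally show ?case .
qed

text \<open>The row identity is summed over the leaves below \<open>m\<close>, whose conditional
  probabilities add up to 1. Hence mass ratios of the product plan recover its factors.\<close>

lemma mass_sinkhorn_plan:
  assumes feas: "stagewise_feasible q"
    and mn: "m \<in> stage A t" "n \<in> stage B t"
  shows "mass (sinkhorn_plan T A B q) m n = sinkhorn_plan t A B q m n"
proof -
  have "mass (sinkhorn_plan T A B q) m n = (\<Sum>i\<in>A.below m. cprob A i m * sinkhorn_plan t A B q m n)"
    unfolding mass_def using sinkhorn_plan_row[OF feas mn] by (intro sum.cong refl)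
  also have "\<dots> = sinkhorn_plan t A B q m n"
    using A.stage_nodes[OF mn(1)] by (simp add: A.sum_cprob_below A.cprob_self flip: sum_distrib_right)
  finally show ?thesis .
qed

lemma sinkhorn_plan_pos:
  assumes feas: "stagewise_feasible q"
    and mn: "m \<in> stage A t" "n \<in> stage B t"
  shows "sinkhorn_plan t A B q m n > 0"
  using A.stage_le[OF mn(1)] mn
proof (induction t arbitrary: m n)
  case 0
  then show ?case by (simp add: sinkhorn_plan_def)
next
  case (Suc t)
  then obtain m' n' where mn': "m' \<in> stage A t" "m \<in> succs A m'" "n' \<in> stage B t" "n \<in> succs B n'"
    by (auto simp: A.stage_Suc_iff B.stage_Suc_iff succs_def)
  moreover have "stage_feasible A B m' n' (q m' n')"
    using feas mn' Suc.prems by (simp add: stagewise_feasible_def Suc_le_eq)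
  then have "q m' n' m n > 0" using mn' by (simp add: stage_feasible_def)
  ultimately show ?case using Suc by (simp add: sinkhorn_plan_Suc)
qed

section \<open>Feasible plans and their one-step conditional probabilities\<close>

lemma plan_cond_eq:
  "m \<in> stage A t \<Longrightarrow> n \<in> stage B t \<Longrightarrow> t < T \<Longrightarrow> plan_cond A B p i j m n = p i j / mass p m n"
  by (simp add: plan_cond_def mass_def A.leaves_below_eq B.leaves_below_eq)

text \<open>Positive plans have positive masses, so the denominators can be cleared, which makes the
  equations linear in \<open>p\<close>; if positivity fails, both sides are false.\<close>

lemma plan_feasible_iff:
  "plan_feasible T A B p \<longleftrightarrow>
     (\<forall>t<T. \<forall>m\<in>stage A t. \<forall>n\<in>stage B t.
        (\<forall>i\<in>A.below m. (\<Sum>j\<in>B.below n. p i j) = cprob A i m * mass p m n) \<and>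
        (\<forall>j\<in>B.below n. (\<Sum>i\<in>A.below m. p i j) = cprob B j n * mass p m n)) \<and>
     (\<forall>i\<in>leaves A. \<forall>j\<in>leaves B. p i j > 0) \<and> mass p (troot A) (troot B) = 1"
proof (cases "\<forall>i\<in>leaves A. \<forall>j\<in>leaves B. p i j > 0")
  case True
  have "(\<Sum>j\<in>leaves_below B n. plan_cond A B p i j m n) = cprob A i m \<longleftrightarrow>
      (\<Sum>j\<in>B.below n. p i j) = cprob A i m * mass p m n"
    "(\<Sum>i\<in>leaves_below A m. plan_cond A B p i j m n) = cprob B j n \<longleftrightarrow>
      (\<Sum>i\<in>A.below m. p i j) = cprob B j n * mass p m n"
    if "t < T" "m \<in> stage A t" "n \<in> stage B t" for t m n i j
  proof -
    have "mass p m n > 0"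
      using that by (intro mass_pos[OF True]) (auto intro: A.stage_nodes B.stage_nodes)
    then show "(\<Sum>j\<in>leaves_below B n. plan_cond A B p i j m n) = cprob A i m \<longleftrightarrow>
      (\<Sum>j\<in>B.below n. p i j) = cprob A i m * mass p m n"
      "(\<Sum>i\<in>leaves_below A m. plan_cond A B p i j m n) = cprob B j n \<longleftrightarrow>
      (\<Sum>i\<in>A.below m. p i j) = cprob B j n * mass p m n"
      using that by (simp_all add: plan_cond_eq A.leaves_below_eq B.leaves_below_eq
          divide_eq_eq flip: sum_divide_distrib)
  qed
  then show ?thesis
    unfolding plan_feasible_def mass_def[of p "troot A"] A.below_root B.below_root
    by (auto simp: A.leaves_below_eq B.leaves_below_eq)
qed (auto simp: plan_feasible_def)

lemma plan_feasible_midpoint: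
  assumes "plan_feasible T A B p" "plan_feasible T A B q"
  shows "plan_feasible T A B (\<lambda>i j. (p i j + q i j) / 2)"
proof -
  have "mass (\<lambda>i j. (p i j + q i j) / 2) m n = (mass p m n + mass q m n) / 2" for m n
    by (simp add: mass_def sum.distrib flip: sum_divide_distrib)
  then show ?thesis
    using assms unfolding plan_feasible_iff
    by (auto simp: sum.distrib distrib_left add_divide_distrib add_pos_pos sum_divide_distrib[symmetric])
qed

text \<open>The row constraint at \<open>(m, n)\<close> applies to every leaf \<open>i\<close> below
  \<open>m'\<close>; summing \<open>cprob A i m\<close> over these leaves gives
  \<open>cprob A m' m\<close>.\<close>

lemma plan_feasible_stage_row:
  assumes p: "plan_feasible T A B p"
    and st: "t < T" "m \<in> stage A t" "n \<in> stage B t" and m': "m' \<in> succs A m"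
  shows "(\<Sum>n'\<in>succs B n. mass p m' n' / mass p m n) = cprob A m' m"
proof -
  have "mass p m n > 0"
    using p st by (intro mass_pos) (auto intro: A.stage_nodes B.stage_nodes simp: plan_feasible_def)
  have "(\<Sum>n'\<in>succs B n. mass p m' n') = (\<Sum>i\<in>A.below m'. \<Sum>n'\<in>succs B n. \<Sum>j\<in>B.below n'. p i j)"
    unfolding mass_def by (rule sum.swap)
  also have "\<dots> = (\<Sum>i\<in>A.below m'. cprob A i m * mass p m n)"
  proof (intro sum.cong refl)
    fix i assume "i \<in> A.below m'"
    with m' have "i \<in> A.below m"
      by (auto simp: A.below_def succs_def intro: converse_rtrancl_into_rtrancl)
    then show "(\<Sum>n'\<in>succs B n. \<Sum>j\<in>B.below n'. p i j) = cprob A i m * mass p m n"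
      using p st by (simp add: plan_feasible_iff flip: B.sum_below)
  qed
  also have "\<dots> = cprob A m' m * mass p m n"
    using A.stage_nodes[OF A.stage_succs[OF st(2) m']]
    by (simp add: A.sum_cprob_below flip: sum_distrib_right)
  finally show ?thesis using \<open>mass p m n > 0\<close> by (simp flip: sum_divide_distrib)
qed

end

text \<open>Columns are obtained as rows of the transposed plan, by interpreting the locale with the
  trees exchanged.\<close>

lemma (in tree_pair) plan_feasible_stagewise:
  assumes p: "plan_feasible T A B p"
  shows "stagewise_feasible (\<lambda>m n m' n'. mass p m' n' / mass p m n)"
  unfolding stagewise_feasible_def
proof (intro allI impI ballI)
  fix t m n
  assume st: "t < T" "m \<in> stage A t" "n \<in> stage B t"
  interpret swap: tree_pair T B A ..
  have mass: "swap.mass (\<lambda>j i. p i j) n m = mass p m n" for m n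
    unfolding mass_def swap.mass_def by (rule sum.swap)
  have "plan_feasible T B A (\<lambda>j i. p i j)"
    using p unfolding plan_feasible_iff swap.plan_feasible_iff mass by blast
  note col = swap.plan_feasible_stage_row[OF this st(1,3,2), unfolded mass]
  have pos: "\<forall>i\<in>leaves A. \<forall>j\<in>leaves B. p i j > 0"
    using p by (simp add: plan_feasible_def)
  have "mass p m' n' / mass p m n > 0" if "m' \<in> succs A m" "n' \<in> succs B n" for m' n'
    using that st by (intro divide_pos_pos mass_pos[OF pos])
      (blast intro: A.stage_nodes B.stage_nodes A.stage_succs B.stage_succs)+
  then show "stage_feasible A B m n (\<lambda>m' n'. mass p m' n' / mass p m n)"
    using plan_feasible_stage_row[OF p st] col by (simp add: stage_feasible_def)
qed

lemma (in tree_pair) plan_feasible_sinkhorn_plan: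
  assumes feas: "stagewise_feasible q"
  shows "plan_feasible T A B (sinkhorn_plan T A B q)"
  unfolding plan_feasible_iff
proof (intro conjI allI impI ballI)
  interpret swap: tree_pair T B A ..
  fix t m n j
  assume st: "m \<in> stage A t" "n \<in> stage B t" and j: "j \<in> B.below n"
  \<comment> \<open>The stage constraints are symmetric in the two trees, so the row identity of the
    exchanged pair yields the column identity.\<close>
  have "swap.stagewise_feasible (\<lambda>n m j i. q m n i j)"
    using feas by (simp add: stagewise_feasible_def swap.stagewise_feasible_def stage_feasible_def)
  from swap.sinkhorn_plan_row[OF this st(2,1) j]
  show "(\<Sum>i\<in>A.below m. sinkhorn_plan T A B q i j) = cprob B j n * mass (sinkhorn_plan T A B q) m n"
    by (simp add: sinkhorn_plan_swap[where q = q] mass_sinkhorn_plan[OF feas st])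
next
  show "mass (sinkhorn_plan T A B q) (troot A) (troot B) = 1"
    using mass_sinkhorn_plan[OF feas, of "troot A" 0 "troot B"]
    by (simp add: A.stage_0 B.stage_0 sinkhorn_plan_def)
next
  fix t m n i
  assume st: "m \<in> stage A t" "n \<in> stage B t" and i: "i \<in> A.below m"
  show "(\<Sum>j\<in>B.below n. sinkhorn_plan T A B q i j) = cprob A i m * mass (sinkhorn_plan T A B q) m n"
    using sinkhorn_plan_row[OF feas st i] by (simp only: mass_sinkhorn_plan[OF feas st])
next
  fix i j
  assume "i \<in> leaves A" "j \<in> leaves B"
  then show "sinkhorn_plan T A B q i j > 0"
    using sinkhorn_plan_pos[OF feas, of i T j] by (simp add: A.stage_T B.stage_T)
qed

section \<open>Optimality and uniqueness of the product plan, and existence of the recursion\<close>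

context tree_pair
begin

lemma entropic_cost_eq_cond_cost:
  assumes "plan_feasible T A B p"
  shows "entropic_cost lam c (leaves A) (leaves B) p = cond_cost lam c p (troot A) (troot B)"
proof -
  have "mass p (troot A) (troot B) = 1" using assms by (simp add: plan_feasible_iff)
  then show ?thesis by (simp add: entropic_cost_def cond_cost_def A.below_root B.below_root)
qed

lemma optimal_plan_sinkhorn_plan:
  assumes ns: "nested_sinkhorn T A B d r lam de q"
  shows "optimal_plan T A B d r lam (sinkhorn_plan T A B q)"
  unfolding optimal_plan_def is_arg_min_linorder
proof (intro conjI allI impI)
  have feas: "stagewise_feasible q"
    using ns by (auto simp: stagewise_feasible_def nested_sinkhorn_def is_arg_min_linorder)
  show S: "plan_feasible T A B (sinkhorn_plan T A B q)"
    using feas by (rule plan_feasible_sinkhorn_plan)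
  have root: "troot A \<in> stage A 0" "troot B \<in> stage B 0" by (simp_all add: A.stage_0 B.stage_0)
  fix p assume p: "plan_feasible T A B p"
  \<comment> \<open>Masses of the product plan are partial products, so each one-step ratio leaves
    just the stage optimiser.\<close>
  have "mass (sinkhorn_plan T A B q) m' n' / mass (sinkhorn_plan T A B q) m n = q m n m' n'"
    if st: "t < T" "m \<in> stage A t" "n \<in> stage B t" and s: "m' \<in> succs A m" "n' \<in> succs B n"
    for t m n m' n'
    using mass_sinkhorn_plan[OF feas st(2,3)]
      mass_sinkhorn_plan[OF feas A.stage_succs[OF st(2) s(1)] B.stage_succs[OF st(3) s(2)]]
      sinkhorn_plan_Suc[OF st(2,3) s, of q] sinkhorn_plan_pos[OF feas st(2,3)]
    by simp
  then have "entropic_cost lam (\<lambda>i j. d i j powr r) (leaves A) (leaves B) (sinkhorn_plan T A B q) =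
      de 0 (troot A) (troot B)"
    using cond_cost_eq[OF ns _ _ root, of "sinkhorn_plan T A B q"] S
    by (simp add: entropic_cost_eq_cond_cost plan_feasible_iff)
  \<comment> \<open>At the root pair, of mass 1, the conditional cost is the full cost, so
    \<open>de 0\<close> bounds the cost of every feasible plan from below.\<close>
  also have "\<dots> \<le> entropic_cost lam (\<lambda>i j. d i j powr r) (leaves A) (leaves B) p"
    using cond_cost_ge[OF ns _ plan_feasible_stagewise[OF p] root] p
    by (simp add: entropic_cost_eq_cond_cost plan_feasible_iff)
  finally show "entropic_cost lam (\<lambda>i j. d i j powr r) (leaves A) (leaves B) (sinkhorn_plan T A B q) \<le>
    entropic_cost lam (\<lambda>i j. d i j powr r) (leaves A) (leaves B) p" .
qed

lemma optimal_plan_unique: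
  assumes "lam > 0" "optimal_plan T A B d r lam p" "optimal_plan T A B d r lam q"
    and "i \<in> leaves A" "j \<in> leaves B"
  shows "p i j = q i j"
  using entropic_cost_minimizer_unique[OF A.finite_leaves B.finite_leaves assms(1)
      assms(2)[unfolded optimal_plan_def] assms(3)[unfolded optimal_plan_def]
      plan_feasible_midpoint _ assms(4,5)]
  by (auto simp: plan_feasible_def)

lemma stage_minimizer_exists:
  assumes "lam > 0" "t < T" "m \<in> stage A t" "n \<in> stage B t"
  shows "\<exists>p. is_arg_min (entropic_cost lam e (succs A m) (succs B n)) (stage_feasible A B m n) p"
  unfolding stage_feasible_def using assms
  by (intro entropic_cost_minimizer_exists A.finite_succs B.finite_succs)
    (auto intro: A.sum_cprob_succs B.sum_cprob_succs
      intro!: A.cprob_pos B.cprob_pos A.stage_nodes B.stage_nodes dest: A.stage_succs B.stage_succs)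

lemma nested_sinkhorn_exists:
  assumes lam: "lam > 0"
  shows "\<exists>de q. nested_sinkhorn T A B d r lam de q"
proof -
  define Q where "Q = (\<lambda>e m n. SOME p.
    is_arg_min (entropic_cost lam e (succs A m) (succs B n)) (stage_feasible A B m n) p)"
  \<comment> \<open>\<open>D k\<close> is the value function \<open>k\<close> stages before the end;
    \<open>de\<close> reverses the index.\<close>
  define D where "D = rec_nat (\<lambda>i j. d i j powr r)
    (\<lambda>_ e m n. entropic_cost lam e (succs A m) (succs B n) (Q e m n))"
  \<comment> \<open>The solution \<open>q m n\<close> takes no stage argument, so the stage is
    recovered from \<open>m\<close>.\<close>
  define st where "st = (\<lambda>m. THE t. m \<in> stage A t)"
  define de where "de = (\<lambda>t. D (T - t))"
  have st: "st m = t" if "m \<in> stage A t" for m t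
    unfolding st_def using that A.stage_unique by blast
  have de: "de t m n = entropic_cost lam (de (Suc t)) (succs A m) (succs B n) (Q (de (Suc t)) m n)"
    if "t < T" for t m n
  proof -
    have "T - t = Suc (T - Suc t)" using that by simp
    then show ?thesis by (simp add: de_def D_def)
  qed
  have "is_arg_min (entropic_cost lam e (succs A m) (succs B n)) (stage_feasible A B m n) (Q e m n)"
    if "t < T" "m \<in> stage A t" "n \<in> stage B t" for t m n e
    unfolding Q_def using stage_minimizer_exists[OF lam that] by (rule someI_ex)
  then have "nested_sinkhorn T A B d r lam de (\<lambda>m n. Q (de (Suc (st m))) m n)"
    using de by (auto simp: nested_sinkhorn_def st) (simp add: de_def D_def)
  then show ?thesis by blast
qed

end

theorem theorem4p1:
  fixes A :: "'a stree" and B :: "'b stree" and T :: nat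
    and d :: "'a \<Rightarrow> 'b \<Rightarrow> real" and r lam :: real
  assumes "scenario_tree T A" and "scenario_tree T B"
    and "\<forall>i \<in> leaves A. \<forall>j \<in> leaves B. d i j \<ge> 0"
    and "r \<ge> 1" and "lam > 0"
  shows "(\<exists>de q. nested_sinkhorn T A B d r lam de q) \<and>
    (\<forall>de q. nested_sinkhorn T A B d r lam de q \<longrightarrow>
       optimal_plan T A B d r lam (sinkhorn_plan T A B q) \<and>
       (\<forall>p. optimal_plan T A B d r lam p \<longrightarrow>
          (\<forall>i \<in> leaves A. \<forall>j \<in> leaves B. p i j = sinkhorn_plan T A B q i j)))"
proof -
  interpret tree_pair T A B by unfold_locales (fact assms)+
  show ?thesis
    using nested_sinkhorn_exists optimal_plan_sinkhorn_plan optimal_plan_unique \<open>lam > 0\<close> by blast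
qed

end
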